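(* For real $x\ge 1$, let $\mathfrak{n}$ and $\mathfrak{m}$ be nonzero ideals chosen independently and uniformly at random from the (finite) set of nonzero ideals of $\mathbb{Z}[i]$ with norm $x$ or less, and let $E_x\{N(\mathfrak{n},\mathfrak{m})^n\}$ denote the $n$-th moment of the norm of the greatest common divisor of $\mathfrak{n}$ and $\mathfrak{m}$, i.e. the expected value of $N((\mathfrak{n},\mathfrak{m}))^n$. Then for every integer $n>2$ there exists a constant $c_n\in\mathbb{R}$ such that $$E_x\{N(\mathfrak{n},\mathfrak{m})^n\}\sim c_n x^{n-1}\qquad\text{as } x\to\infty.$$
   Context: For a Gaussian integer $\alpha=a+bi$ with $a,b\in\mathbb{Z}$, the norm is $N(\alpha)=a^2+b^2$. Every ideal $\mathfrak{n}$ of $\mathbb{Z}[i]$ is principal, $\mathfrak{n}=(\eta)$, and its norm is $N(\mathfrak{n})=N(\eta)$. The greatest common divisor $(\mathfrak{n},\mathfrak{m})$ of two ideals is the smallest ideal containing both, i.e. the ideal $\mathfrak{K}$ with $\mathfrak{n}\subset\mathfrak{K}$, $\mathfrak{m}\subset\mathfrak{K}$, and such that $\mathfrak{K}\subset\mathfrak{a}$ for every ideal $\mathfrak{a}$ containing both $\mathfrak{n}$ and $\mathfrak{m}$. The notation $f(x)\sim g(x)$ as $x\to\infty$ means $f(x)/g(x)\to 1$ (so in particular $c_n\neq 0$). *)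

theory Defs
  imports
    "HOL-Algebra.Ring_Divisibility"
    "HOL-Library.Landau_Symbols"
    "HOL-Probability.Probability_Mass_Function"
begin

definition gauss_ring :: "complex ring" where
  "gauss_ring =
     \<lparr>carrier = {Complex (of_int a) (of_int b) | a b. True},
      mult = (*), one = 1, zero = 0, add = (+)\<rparr>"

definition gauss_norm :: "complex \<Rightarrow> real" where
  "gauss_norm \<alpha> = (Re \<alpha>)\<^sup>2 + (Im \<alpha>)\<^sup>2"

(* The description is legitimate for every ideal: a generator exists by
   principal_domain_gauss_ring, and the value does not depend on it by ideal_norm_PIdl. *)
definition ideal_norm :: "complex set \<Rightarrow> real" where
  "ideal_norm I =
     (THE k. \<exists>\<eta>\<in>carrier gauss_ring. I = PIdl\<^bsub>gauss_ring\<^esub> \<eta> \<and> k = gauss_norm \<eta>)"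

(* The smallest ideal containing both I and J; see ideal_gcd_smallest. *)
definition ideal_gcd :: "complex set \<Rightarrow> complex set \<Rightarrow> complex set" where
  "ideal_gcd I J = Idl\<^bsub>gauss_ring\<^esub> (I \<union> J)"

definition ideals_upto :: "real \<Rightarrow> complex set set" where
  "ideals_upto x =
     {I. ideal I gauss_ring \<and> I \<noteq> {\<zero>\<^bsub>gauss_ring\<^esub>} \<and> ideal_norm I \<le> x}"

(* pmf_of_set is the uniform distribution only on a finite nonempty set; ideals_upto x is one
   for x \<ge> 1, by finite_ideals_upto and ideals_upto_nonempty. *)
definition gcd_moment :: "real \<Rightarrow> nat \<Rightarrow> real" where
  "gcd_moment x n =
     measure_pmf.expectation
       (pair_pmf (pmf_of_set (ideals_upto x)) (pmf_of_set (ideals_upto x)))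
       (\<lambda>(I, J). ideal_norm (ideal_gcd I J) ^ n)"

lemma gauss_ring_simps [simp]:
  "mult gauss_ring = (*)" "one gauss_ring = 1" "zero gauss_ring = 0" "add gauss_ring = (+)"
  by (simp_all add: gauss_ring_def)

lemma carrier_gauss_ring: "z \<in> carrier gauss_ring \<longleftrightarrow> Re z \<in> \<int> \<and> Im z \<in> \<int>"
  by (cases z) (auto simp: gauss_ring_def Ints_def)

lemma domain_gauss_ring: "domain gauss_ring"
proof (intro domain.intro domain_axioms.intro cringI abelian_groupI comm_monoidI)
  fix x assume "x \<in> carrier gauss_ring"
  then have "- x \<in> carrier gauss_ring" by (auto simp: carrier_gauss_ring)
  then show "\<exists>y\<in>carrier gauss_ring. y \<oplus>\<^bsub>gauss_ring\<^esub> x = \<zero>\<^bsub>gauss_ring\<^esub>"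
    by (rule rev_bexI) simp
qed (auto simp: carrier_gauss_ring algebra_simps)

lemma gauss_norm_mult: "gauss_norm (x * y) = gauss_norm x * gauss_norm y"
  by (simp add: gauss_norm_def algebra_simps power2_eq_square)

lemma gauss_norm_eq_cmod: "gauss_norm z = (cmod z)\<^sup>2"
  by (simp add: gauss_norm_def cmod_def)

lemma gauss_norm_Ints: "z \<in> carrier gauss_ring \<Longrightarrow> gauss_norm z \<in> \<int>"
  by (auto simp: carrier_gauss_ring gauss_norm_def)

lemma gauss_norm_ge_1:
  assumes "z \<in> carrier gauss_ring" "z \<noteq> 0"
  shows "gauss_norm z \<ge> 1"
proof -
  obtain k where k: "gauss_norm z = of_int k"
    using gauss_norm_Ints[OF assms(1)] by (auto elim: Ints_cases)
  have "gauss_norm z > 0" using assms(2) by (simp add: gauss_norm_eq_cmod)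
  with k show ?thesis by simp
qed

lemma euclidean_domain_gauss_ring:
  "euclidean_domain gauss_ring (\<lambda>z. nat \<lfloor>gauss_norm z\<rfloor>)"
proof (rule domain.euclidean_domainI[OF domain_gauss_ring])
  fix a b assume "a \<in> carrier gauss_ring - {\<zero>\<^bsub>gauss_ring\<^esub>}"
    and "b \<in> carrier gauss_ring - {\<zero>\<^bsub>gauss_ring\<^esub>}"
  then have a: "a \<in> carrier gauss_ring" and b: "b \<in> carrier gauss_ring" "b \<noteq> 0"
    by auto
  define q where "q = Complex (of_int (round (Re (a / b)))) (of_int (round (Im (a / b))))"
  define r where "r = a - b * q"
  have q: "q \<in> carrier gauss_ring" by (simp add: carrier_gauss_ring q_def)
  then have r: "r \<in> carrier gauss_ring"
    using a b by (auto simp: carrier_gauss_ring r_def)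
  have half: "(t - of_int (round t))\<^sup>2 \<le> 1 / 4" for t :: real
    using of_int_round_abs_le[of t] abs_le_square_iff[of "t - of_int (round t)" "1 / 2"]
    by (simp add: abs_minus_commute power2_eq_square)
  have "gauss_norm (a / b - q) \<le> 1 / 4 + 1 / 4"
    unfolding gauss_norm_def q_def minus_complex.sel complex.sel by (intro add_mono half)
  moreover have "r = b * (a / b - q)" using b by (simp add: r_def field_simps)
  ultimately have "gauss_norm r \<le> gauss_norm b * (1 / 2)"
    unfolding gauss_norm_mult using gauss_norm_ge_1[OF b]
    by (simp add: gauss_norm_mult mult_left_mono)
  then have "gauss_norm r < gauss_norm b" using gauss_norm_ge_1[OF b] by linarith
  moreover obtain k l where "gauss_norm r = of_int k" "gauss_norm b = of_int l"
    using gauss_norm_Ints r b by (metis Ints_cases)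
  ultimately have "nat \<lfloor>gauss_norm r\<rfloor> < nat \<lfloor>gauss_norm b\<rfloor>"
    using gauss_norm_ge_1[OF b] by simp
  then show "\<exists>q r. q \<in> carrier gauss_ring \<and> r \<in> carrier gauss_ring \<and>
      a = b \<otimes>\<^bsub>gauss_ring\<^esub> q \<oplus>\<^bsub>gauss_ring\<^esub> r \<and>
      (r = \<zero>\<^bsub>gauss_ring\<^esub> \<or> nat \<lfloor>gauss_norm r\<rfloor> < nat \<lfloor>gauss_norm b\<rfloor>)"
    using q r by (intro exI[of _ q] exI[of _ r]) (auto simp: r_def)
qed

lemma principal_domain_gauss_ring: "principal_domain gauss_ring"
proof -
  interpret euclidean_domain gauss_ring "\<lambda>z. nat \<lfloor>gauss_norm z\<rfloor>"
    by (rule euclidean_domain_gauss_ring)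
  show ?thesis by (rule principal_domain_axioms)
qed

interpretation gauss: cring gauss_ring
  by (rule domain.axioms(1)[OF domain_gauss_ring])

lemma gauss_norm_le_of_mem_PIdl:
  assumes "x \<in> PIdl\<^bsub>gauss_ring\<^esub> y" "x \<noteq> 0"
  shows "gauss_norm y \<le> gauss_norm x"
proof -
  obtain u where "u \<in> carrier gauss_ring" "x = u * y"
    using assms(1) by (auto simp: cgenideal_def)
  moreover from this assms(2) have "gauss_norm u \<ge> 1" by (intro gauss_norm_ge_1) auto
  moreover have "gauss_norm y \<ge> 0" by (simp add: gauss_norm_def)
  ultimately show ?thesis
    using mult_right_mono[of 1 "gauss_norm u" "gauss_norm y"] by (simp add: gauss_norm_mult)
qed

lemma ideal_norm_PIdl:
  assumes "\<eta> \<in> carrier gauss_ring"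
  shows "ideal_norm (PIdl\<^bsub>gauss_ring\<^esub> \<eta>) = gauss_norm \<eta>"
  unfolding ideal_norm_def
proof (rule the_equality)
  fix k assume "\<exists>\<eta>'\<in>carrier gauss_ring.
    PIdl\<^bsub>gauss_ring\<^esub> \<eta> = PIdl\<^bsub>gauss_ring\<^esub> \<eta>' \<and> k = gauss_norm \<eta>'"
  then obtain \<eta>' where c: "\<eta>' \<in> carrier gauss_ring" and
    eq: "PIdl\<^bsub>gauss_ring\<^esub> \<eta> = PIdl\<^bsub>gauss_ring\<^esub> \<eta>'" and k: "k = gauss_norm \<eta>'"
    by blast
  have mem: "\<eta> \<in> PIdl\<^bsub>gauss_ring\<^esub> \<eta>'" "\<eta>' \<in> PIdl\<^bsub>gauss_ring\<^esub> \<eta>"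
    using gauss.cgenideal_self[OF assms] gauss.cgenideal_self[OF c] eq by auto
  then have "\<eta> = 0 \<longleftrightarrow> \<eta>' = 0" by (auto simp: cgenideal_def)
  then show "k = gauss_norm \<eta>"
    using k gauss_norm_le_of_mem_PIdl[OF mem(1)] gauss_norm_le_of_mem_PIdl[OF mem(2)]
    by (cases "\<eta> = 0") auto
qed (use assms in blast)

lemma ideal_gcd_smallest:
  assumes "ideal I gauss_ring" "ideal J gauss_ring"
  shows "ideal (ideal_gcd I J) gauss_ring" "I \<subseteq> ideal_gcd I J" "J \<subseteq> ideal_gcd I J"
    and "\<And>K. ideal K gauss_ring \<Longrightarrow> I \<subseteq> K \<Longrightarrow> J \<subseteq> K \<Longrightarrow> ideal_gcd I J \<subseteq> K"
proof -
  have sub: "I \<union> J \<subseteq> carrier gauss_ring"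
    using assms by (simp add: additive_subgroup.a_subset ideal.axioms(1))
  show "ideal (ideal_gcd I J) gauss_ring"
    unfolding ideal_gcd_def by (rule gauss.genideal_ideal[OF sub])
  show "I \<subseteq> ideal_gcd I J" "J \<subseteq> ideal_gcd I J"
    using gauss.genideal_self[OF sub] by (auto simp: ideal_gcd_def)
  show "ideal_gcd I J \<subseteq> K" if "ideal K gauss_ring" "I \<subseteq> K" "J \<subseteq> K" for K
    unfolding ideal_gcd_def using that by (intro gauss.genideal_minimal) auto
qed

lemma finite_ideals_upto: "finite (ideals_upto x)"
proof -
  define B where "B = (\<lambda>(a, b). Complex (of_int a) (of_int b)) `
    ({- \<lceil>x\<rceil>..\<lceil>x\<rceil>} \<times> {- \<lceil>x\<rceil>..\<lceil>x\<rceil>})"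
  have "ideals_upto x \<subseteq> (\<lambda>\<eta>. PIdl\<^bsub>gauss_ring\<^esub> \<eta>) ` B"
  proof
    fix I assume I: "I \<in> ideals_upto x"
    then obtain \<eta> where \<eta>: "\<eta> \<in> carrier gauss_ring" "I = PIdl\<^bsub>gauss_ring\<^esub> \<eta>"
      using principal_domain.exists_gen[OF principal_domain_gauss_ring] by (auto simp: ideals_upto_def)
    then obtain a b where ab: "\<eta> = Complex (of_int a) (of_int b)"
      by (auto simp: gauss_ring_def)
    have "gauss_norm \<eta> \<le> x" using I \<eta> by (simp add: ideals_upto_def ideal_norm_PIdl)
    then have "of_int (a\<^sup>2 + b\<^sup>2) \<le> x" by (simp add: ab gauss_norm_def)
    then have le: "a\<^sup>2 + b\<^sup>2 \<le> \<lceil>x\<rceil>" by linarith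
    have sq: "\<bar>t\<bar> \<le> t\<^sup>2" for t :: int
      using mult_left_mono[of 1 "\<bar>t\<bar>" "\<bar>t\<bar>"] by (cases "t = 0") (auto simp: power2_eq_square)
    have "\<bar>a\<bar> \<le> \<lceil>x\<rceil>" "\<bar>b\<bar> \<le> \<lceil>x\<rceil>"
      using le sq[of a] sq[of b] zero_le_power2[of a] zero_le_power2[of b] by linarith+
    then have "\<eta> \<in> B" unfolding B_def ab by (intro image_eqI[of _ _ "(a, b)"]) auto
    with \<eta> show "I \<in> (\<lambda>\<eta>. PIdl\<^bsub>gauss_ring\<^esub> \<eta>) ` B" by blast
  qed
  moreover have "finite B" by (simp add: B_def)
  ultimately show ?thesis by (rule finite_subset[OF _ finite_imageI])
qed

lemma ideals_upto_nonempty: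
  assumes "x \<ge> 1"
  shows "ideals_upto x \<noteq> {}"
proof -
  have one: "(1 :: complex) \<in> carrier gauss_ring" by (simp add: carrier_gauss_ring)
  have "1 \<in> PIdl\<^bsub>gauss_ring\<^esub> 1" by (rule gauss.cgenideal_self[OF one])
  then have "PIdl\<^bsub>gauss_ring\<^esub> 1 \<noteq> {0}" by (metis singletonD zero_neq_one)
  moreover have "ideal_norm (PIdl\<^bsub>gauss_ring\<^esub> 1) \<le> x"
    using assms by (subst ideal_norm_PIdl[OF one]) (simp add: gauss_norm_def)
  ultimately have "PIdl\<^bsub>gauss_ring\<^esub> 1 \<in> ideals_upto x"
    using gauss.cgenideal_ideal[OF one] by (simp add: ideals_upto_def)
  then show ?thesis by blast
qed

end

theory Submission
  imports Defs "HOL-Analysis.Ball_Volume"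
begin

text \<open>
  Every nonzero ideal has exactly four generators, so the moment may be computed with random nonzero
  Gaussian integers $z$, $w$ of norm at most $x$. Writing $(z, w) = (ka, kb)$ with $a$, $b$ coprime
  and $k$ one of the four generators of the greatest common divisor, four times the sum of
  $N((z, w))^n$ equals the sum of $S_n(x / \max(N(a), N(b)))$ over all coprime pairs $(a, b)$, where
  $S_n(y)$ is the sum of $N(k)^n$ over $0 < N(k) \le y$. Counting lattice points in a disc and
  summing by parts gives $S_n(y) \sim \pi y^{n+1} / (n+1)$. There are $O(m^2)$ coprime pairs with
  $\max(N(a), N(b)) = m$, so for $n > 2$ the series of $\max(N(a), N(b))^{-(n+1)}$ over coprime pairs
  converges, and by dominated convergence the sum is asymptotic to a positive multiple of $x^{n+1}$;
  it remains to divide by the number $\sim (\pi x)^2$ of pairs $(z, w)$.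
\<close>

subsection \<open>Gaussian integers of bounded norm\<close>

abbreviation Zi :: "complex set" where
  "Zi \<equiv> carrier gauss_ring"

text \<open>These are the generators of the ideals in \<open>ideals_upto x\<close>, so sums over
  ideals become sums over lattice points of a punctured disc.\<close>

definition gauss_upto :: "real \<Rightarrow> complex set" where
  "gauss_upto x = {z \<in> Zi. z \<noteq> 0 \<and> gauss_norm z \<le> x}"

lemma Zi_closed [intro, simp]:
  "0 \<in> Zi" "1 \<in> Zi" "\<i> \<in> Zi"
  "x \<in> Zi \<Longrightarrow> y \<in> Zi \<Longrightarrow> x + y \<in> Zi"
  "x \<in> Zi \<Longrightarrow> y \<in> Zi \<Longrightarrow> x * y \<in> Zi"
  "x \<in> Zi \<Longrightarrow> - x \<in> Zi"
  by (auto simp: carrier_gauss_ring)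

lemma gauss_norm_nonneg [simp]: "gauss_norm z \<ge> 0"
  by (simp add: gauss_norm_def)

lemma finite_Zi_norm_le: "finite {z \<in> Zi. gauss_norm z \<le> x}"
proof -
  have "finite {t \<in> \<int>. \<bar>t\<bar> \<le> sqrt x}"
    using finite_abs_int_segment by blast
  moreover have "{z \<in> Zi. gauss_norm z \<le> x} \<subseteq>
      (\<lambda>(a, b). Complex a b) ` ({t \<in> \<int>. \<bar>t\<bar> \<le> sqrt x} \<times> {t \<in> \<int>. \<bar>t\<bar> \<le> sqrt x})"
  proof
    fix z assume z: "z \<in> {z \<in> Zi. gauss_norm z \<le> x}"
    then have "cmod z \<le> sqrt x"
      by (simp add: gauss_norm_eq_cmod real_le_rsqrt)
    then have "\<bar>Re z\<bar> \<le> sqrt x" "\<bar>Im z\<bar> \<le> sqrt x"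
      using abs_Re_le_cmod[of z] abs_Im_le_cmod[of z] by linarith+
    then show "z \<in> (\<lambda>(a, b). Complex a b) `
        ({t \<in> \<int>. \<bar>t\<bar> \<le> sqrt x} \<times> {t \<in> \<int>. \<bar>t\<bar> \<le> sqrt x})"
      using z by (intro image_eqI[of _ _ "(Re z, Im z)"]) (auto simp: carrier_gauss_ring)
  qed
  ultimately show ?thesis by (meson finite_SigmaI finite_imageI finite_subset)
qed

lemma finite_gauss_upto [simp]: "finite (gauss_upto x)"
  unfolding gauss_upto_def by (rule finite_subset[OF _ finite_Zi_norm_le[of x]]) auto

text \<open>The area comparison counts the origin, which generates the zero ideal and is absent from
  \<open>gauss_upto\<close>.\<close>

lemma card_Zi_norm_le:
  assumes "x \<ge> 0"
  shows "card {z \<in> Zi. gauss_norm z \<le> x} = Suc (card (gauss_upto x))"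
proof -
  have "{z \<in> Zi. gauss_norm z \<le> x} = insert 0 (gauss_upto x)"
    using assms by (auto simp: gauss_upto_def gauss_norm_def)
  moreover have "0 \<notin> gauss_upto x" by (simp add: gauss_upto_def)
  ultimately show ?thesis by simp
qed

lemma gauss_upto_empty: "x < 1 \<Longrightarrow> gauss_upto x = {}"
  using gauss_norm_ge_1 by (force simp: gauss_upto_def)

section \<open>Counting lattice points in a disc by comparing areas\<close>

lemma content_unit_square:
  "measure lborel (cbox z (z + (1 + \<i>))) = 1" "measure lborel (box z (z + (1 + \<i>))) = 1"
  by (simp_all add: measure_lborel_cbox_eq measure_lborel_box_eq Basis_complex_def)

lemma cmod_unit_square:
  assumes "w \<in> cbox z (z + (1 + \<i>))"
  shows "cmod (w - z) \<le> sqrt 2"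
proof -
  have "(Re (w - z))\<^sup>2 \<le> 1\<^sup>2" "(Im (w - z))\<^sup>2 \<le> 1\<^sup>2"
    using assms by (intro power_mono; simp add: in_cbox_complex_iff)+
  then show ?thesis by (simp add: cmod_def)
qed

text \<open>Each lattice point is the lower left corner of an open unit square. These squares are
  disjoint, and as their diagonal is \<open>sqrt 2\<close> they all lie in the disc of radius
  \<open>sqrt x + sqrt 2\<close>.\<close>

lemma card_Zi_norm_le_upper:
  assumes "x \<ge> 0"
  shows "real (card {z \<in> Zi. gauss_norm z \<le> x}) \<le> pi * (sqrt x + sqrt 2)\<^sup>2"
proof -
  define L where "L = {z \<in> Zi. gauss_norm z \<le> x}"
  have fin: "finite L" unfolding L_def by (rule finite_Zi_norm_le)
  have disj: "disjoint_family_on (\<lambda>z. box z (z + (1 + \<i>))) L"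
    unfolding disjoint_family_on_def
  proof (intro ballI impI)
    fix z w assume zw: "z \<in> L" "w \<in> L" "z \<noteq> w"
    then have "z \<in> Zi" "w \<in> Zi" by (auto simp: L_def)
    then obtain a b c d where z: "z = Complex (of_int a) (of_int b)"
      and w: "w = Complex (of_int c) (of_int d)" by (auto simp: gauss_ring_def)
    show "box z (z + (1 + \<i>)) \<inter> box w (w + (1 + \<i>)) = {}"
    proof (rule ccontr)
      assume "\<not> ?thesis"
      then obtain u where "u \<in> box z (z + (1 + \<i>))" "u \<in> box w (w + (1 + \<i>))" by auto
      then have "a < c + 1" "c < a + 1" "b < d + 1" "d < b + 1"
        by (auto simp: in_box_complex_iff z w)
      then show False using zw z w by simp
    qed
  qed
  have "real (card L) = (\<Sum>z\<in>L. measure lborel (box z (z + (1 + \<i>))))"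
    by (simp only: content_unit_square) simp
  also have "\<dots> = measure lborel (\<Union>z\<in>L. box z (z + (1 + \<i>)))"
    using fin disj emeasure_lborel_box_finite
    by (intro measure_finite_Union[symmetric]) (auto simp: less_top)
  also have "\<dots> \<le> measure lborel (cball (0::complex) (sqrt x + sqrt 2))"
  proof (rule measure_mono_fmeasurable)
    show "(\<Union>z\<in>L. box z (z + (1 + \<i>))) \<subseteq> cball 0 (sqrt x + sqrt 2)"
    proof
      fix w assume "w \<in> (\<Union>z\<in>L. box z (z + (1 + \<i>)))"
      then obtain z where z: "z \<in> L" "w \<in> cbox z (z + (1 + \<i>))"
        using box_subset_cbox by blast
      then have "cmod z \<le> sqrt x"
        by (simp add: L_def gauss_norm_eq_cmod real_le_rsqrt)
      then show "w \<in> cball 0 (sqrt x + sqrt 2)"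
        using cmod_unit_square[OF z(2)] norm_triangle_sub[of w z] by simp
    qed
    show "cball (0::complex) (sqrt x + sqrt 2) \<in> fmeasurable lborel"
      by (rule fmeasurable_compact) simp
  qed (use fin in auto)
  also have "\<dots> = pi * (sqrt x + sqrt 2)\<^sup>2"
    using assms by (subst content_cball) (auto simp: unit_ball_vol_2)
  finally show ?thesis by (simp add: L_def)
qed

text \<open>Here closed squares cover a disc: rounding both coordinates of \<open>w\<close> down
  gives the corner of a square containing \<open>w\<close>, and for \<open>w\<close> in the smaller
  disc this corner has modulus at most \<open>sqrt x\<close>. The assumption
  \<open>x \<ge> 2\<close> makes the radius nonnegative.\<close>

lemma card_Zi_norm_le_lower:
  assumes "x \<ge> 2"
  shows "pi * (sqrt x - sqrt 2)\<^sup>2 \<le> real (card {z \<in> Zi. gauss_norm z \<le> x})"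
proof -
  define L where "L = {z \<in> Zi. gauss_norm z \<le> x}"
  have fin: "finite L" unfolding L_def by (rule finite_Zi_norm_le)
  have "pi * (sqrt x - sqrt 2)\<^sup>2 = measure lborel (cball (0::complex) (sqrt x - sqrt 2))"
    using assms by (subst content_cball) (auto simp: unit_ball_vol_2)
  also have "\<dots> \<le> measure lborel (\<Union>z\<in>L. cbox z (z + (1 + \<i>)))"
  proof (rule measure_mono_fmeasurable)
    show "cball 0 (sqrt x - sqrt 2) \<subseteq> (\<Union>z\<in>L. cbox z (z + (1 + \<i>)))"
    proof
      fix w :: complex assume w: "w \<in> cball 0 (sqrt x - sqrt 2)"
      define z where "z = Complex (of_int \<lfloor>Re w\<rfloor>) (of_int \<lfloor>Im w\<rfloor>)"
      have wz: "w \<in> cbox z (z + (1 + \<i>))"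
        by (simp add: in_cbox_complex_iff z_def)
      have "cmod z \<le> sqrt x"
        using cmod_unit_square[OF wz] norm_triangle_sub[of z w] w
        by (simp add: norm_minus_commute)
      then have "gauss_norm z \<le> (sqrt x)\<^sup>2"
        unfolding gauss_norm_eq_cmod by (intro power_mono) auto
      then have "z \<in> L"
        using assms by (simp add: L_def carrier_gauss_ring z_def)
      with wz show "w \<in> (\<Union>z\<in>L. cbox z (z + (1 + \<i>)))" by blast
    qed
    show "(\<Union>z\<in>L. cbox z (z + (1 + \<i>))) \<in> fmeasurable lborel"
      using fin by (intro fmeasurable_compact compact_UN) auto
  qed auto
  also have "\<dots> \<le> (\<Sum>z\<in>L. measure lborel (cbox z (z + (1 + \<i>))))"
    using fin by (intro measure_UNION_le) auto
  also have "\<dots> = real (card L)"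
    by (simp only: content_unit_square) simp
  finally show ?thesis by (simp add: L_def)
qed

text \<open>Expanding the two squares leaves \<open>2 * sqrt 2 * pi * sqrt x\<close> and a bounded
  term, which for \<open>x \<ge> 1\<close> is absorbed into \<open>2 * pi * sqrt x\<close>.\<close>

lemma card_gauss_upto_approx:
  assumes "x \<ge> 1"
  shows "\<bar>real (card (gauss_upto x)) - pi * x\<bar> \<le> (2 * sqrt 2 + 2) * pi * sqrt x"
proof -
  define s where "s = sqrt x"
  have s: "s \<ge> 1" "x = s\<^sup>2" using assms by (auto simp: s_def)
  have card: "real (card {z \<in> Zi. gauss_norm z \<le> x}) = real (card (gauss_upto x)) + 1"
    using card_Zi_norm_le[of x] assms by simp
  have pis: "pi \<le> pi * s" using s mult_left_mono[of 1 s pi] by simp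
  have "real (card (gauss_upto x)) \<le> pi * (s + sqrt 2)\<^sup>2"
    using card_Zi_norm_le_upper[of x] assms card by (simp add: s_def)
  also have "\<dots> = pi * x + 2 * sqrt 2 * pi * s + 2 * pi"
    by (simp add: s power2_sum algebra_simps)
  finally have upper: "real (card (gauss_upto x)) \<le> pi * x + 2 * sqrt 2 * pi * s + 2 * pi" .
  have lower: "real (card (gauss_upto x)) \<ge> pi * x - 2 * sqrt 2 * pi * s - 2 * pi * s"
  proof (cases "x \<ge> 2")
    case True
    have "pi * x - 2 * sqrt 2 * pi * s + 2 * pi = pi * (s - sqrt 2)\<^sup>2"
      by (simp add: s power2_diff algebra_simps)
    also have "\<dots> \<le> real (card (gauss_upto x)) + 1"
      using card_Zi_norm_le_lower[OF True] card by (simp add: s_def)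
    finally show ?thesis using pis pi_gt3 by linarith
  next
    case False
    \<comment> \<open>Below 2 the claimed lower bound is not positive, since
      \<open>s < sqrt 2\<close> makes \<open>s * s\<close> at most
      \<open>2 * sqrt 2 * s\<close>.\<close>
    then have "s < sqrt 2" by (simp add: s_def)
    then have "pi * s * s \<le> pi * s * (2 * sqrt 2)"
      using s by (intro mult_left_mono) auto
    moreover have "0 \<le> pi * s" using s by simp
    moreover have "pi * x = pi * s * s" by (simp add: s power2_eq_square)
    moreover have "pi * s * (2 * sqrt 2) = 2 * sqrt 2 * pi * s" by simp
    ultimately have "pi * x - 2 * sqrt 2 * pi * s - 2 * pi * s \<le> 0"
      by linarith
    then show ?thesis by linarith
  qed
  have "(2 * sqrt 2 + 2) * pi * s = 2 * sqrt 2 * pi * s + 2 * pi * s"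
    by (simp add: algebra_simps)
  then show ?thesis unfolding s_def[symmetric] abs_le_iff using upper lower pis
    by linarith
qed

text \<open>Cruder than the previous estimate but valid down to 0, because no nonzero Gaussian
  integer has norm below 1. A bound at every scale is what the later majorant needs.\<close>

lemma card_gauss_upto_le:
  obtains C where "C > 0" "\<And>x. x \<ge> 0 \<Longrightarrow> real (card (gauss_upto x)) \<le> C * x"
proof
  define C where "C = pi + (2 * sqrt 2 + 2) * pi"
  show "C > 0" unfolding C_def by (intro add_pos_pos mult_pos_pos) auto
  fix x :: real assume x: "x \<ge> 0"
  show "real (card (gauss_upto x)) \<le> C * x"
  proof (cases "x \<ge> 1")
    case True
    then have "sqrt x \<le> x" by (simp add: power2_eq_square real_le_lsqrt)
    then have "(2 * sqrt 2 + 2) * pi * sqrt x \<le> (2 * sqrt 2 + 2) * pi * x"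
      by (intro mult_left_mono) auto
    then show ?thesis
      using card_gauss_upto_approx[OF True] by (simp add: C_def algebra_simps abs_le_iff)
  next
    case False
    then show ?thesis using x \<open>C > 0\<close> by (simp add: gauss_upto_empty)
  qed
qed

lemma card_gauss_upto_tendsto:
  "((\<lambda>x. real (card (gauss_upto x)) / x) \<longlongrightarrow> pi) at_top"
proof -
  define C where "C = (2 * sqrt 2 + 2) * pi"
  have "((\<lambda>x. real (card (gauss_upto x)) / x - pi) \<longlongrightarrow> 0) at_top"
  proof (rule Lim_null_comparison)
    show "\<forall>\<^sub>F x in at_top. norm (real (card (gauss_upto x)) / x - pi) \<le> C / sqrt x"
      using eventually_ge_at_top[of 1]
    proof eventually_elim
      case (elim x)
      have "norm (real (card (gauss_upto x)) / x - pi) = \<bar>real (card (gauss_upto x)) - pi * x\<bar> / x"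
        using elim by (simp add: field_simps)
      also have "\<dots> \<le> C * sqrt x / x"
        unfolding C_def by (intro divide_right_mono card_gauss_upto_approx) (use elim in auto)
      also have "\<dots> = C / sqrt x"
        using elim by (simp add: field_simps)
      finally show ?case .
    qed
    show "((\<lambda>x. C / sqrt x) \<longlongrightarrow> 0) at_top"
      by (intro tendsto_divide_0[OF tendsto_const] filterlim_at_top_imp_at_infinity sqrt_at_top)
  qed
  then show ?thesis by (simp add: LIM_zero_iff)
qed

subsection \<open>Sums of powers of norms\<close>

definition gauss_power_sum :: "nat \<Rightarrow> real \<Rightarrow> real" where
  "gauss_power_sum n x = (\<Sum>z\<in>gauss_upto x. gauss_norm z ^ n)"

lemma gauss_power_sum_nonneg [simp]: "gauss_power_sum n x \<ge> 0"
  by (simp add: gauss_power_sum_def sum_nonneg)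

text \<open>Each term is at most \<open>x ^ n\<close> and the number of terms is linear in
  \<open>x\<close>. The bound is later applied at \<open>x / real m\<close> for every
  \<open>m \<ge> 1\<close>, also beyond \<open>x\<close>, and yields the majorant for dominated
  convergence.\<close>

lemma gauss_power_sum_le:
  obtains C where "C > 0" "\<And>x. x \<ge> 0 \<Longrightarrow> gauss_power_sum n x \<le> C * x ^ Suc n"
proof -
  obtain C where C: "C > 0" "\<And>x. x \<ge> 0 \<Longrightarrow> real (card (gauss_upto x)) \<le> C * x"
    using card_gauss_upto_le by blast
  have "gauss_power_sum n x \<le> C * x ^ Suc n" if "x \<ge> 0" for x
  proof -
    have "gauss_power_sum n x \<le> real (card (gauss_upto x)) * x ^ n"
      unfolding gauss_power_sum_def
      by (rule sum_bounded_above) (auto simp: gauss_upto_def intro!: power_mono)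
    also have "\<dots> \<le> C * x * x ^ n"
      using C(2)[OF that] that by (intro mult_right_mono) auto
    finally show ?thesis by (simp add: mult.assoc)
  qed
  with C(1) show ?thesis by (rule that)
qed

text \<open>Norms are integers, so the asymptotics of the power sums can be established along
  integers first.\<close>

lemma gauss_upto_floor:
  assumes "x \<ge> 0"
  shows "gauss_upto (real (nat \<lfloor>x\<rfloor>)) = gauss_upto x"
proof -
  have "gauss_norm z \<le> real (nat \<lfloor>x\<rfloor>) \<longleftrightarrow> gauss_norm z \<le> x" if z: "z \<in> Zi" for z
  proof -
    obtain k where k: "gauss_norm z = of_int k"
      using gauss_norm_Ints[OF z] by (auto elim: Ints_cases)
    have "real (nat \<lfloor>x\<rfloor>) = of_int \<lfloor>x\<rfloor>" using assms by simp
    then show ?thesis unfolding k by (simp add: le_floor_iff)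
  qed
  then show ?thesis by (auto simp: gauss_upto_def)
qed

lemma gauss_upto_Suc:
  "gauss_upto (real (Suc N)) = gauss_upto (real N) \<union> {z \<in> Zi. gauss_norm z = real (Suc N)}"
proof -
  have "gauss_norm z \<le> real (Suc N) \<longleftrightarrow> gauss_norm z \<le> real N \<or> gauss_norm z = real (Suc N)"
    if z: "z \<in> Zi" for z
  proof -
    obtain k where k: "gauss_norm z = of_int k"
      using gauss_norm_Ints[OF z] by (auto elim: Ints_cases)
    have "k \<le> int (Suc N) \<longleftrightarrow> k \<le> int N \<or> k = int (Suc N)" by linarith
    then show ?thesis unfolding k by linarith
  qed
  then show ?thesis by (auto simp: gauss_upto_def gauss_norm_def)
qed

text \<open>Summation by parts, with the error term of the lattice point count in place of the count.\<close>

lemma gauss_power_sum_by_parts: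
  assumes "\<And>m. m \<le> N \<Longrightarrow> \<bar>real (card (gauss_upto (real m))) - pi * real m\<bar> \<le> B"
  shows "\<bar>gauss_power_sum n (real N) - pi * (\<Sum>m=1..N. real m ^ n)
           - (real (card (gauss_upto (real N))) - pi * real N) * real N ^ n\<bar> \<le> B * real N ^ n"
  using assms
proof (induction N)
  case 0
  have "B \<ge> 0" using 0[of 0] by simp
  then show ?case by (simp add: gauss_power_sum_def gauss_upto_empty)
next
  case (Suc N)
  define R where "R = {z \<in> Zi. gauss_norm z = real (Suc N)}"
  have R: "gauss_upto (real (Suc N)) = gauss_upto (real N) \<union> R"
    unfolding R_def by (rule gauss_upto_Suc)
  have fin: "finite R"
    unfolding R_def by (rule finite_subset[OF _ finite_Zi_norm_le[of "real (Suc N)"]]) auto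
  have disj: "gauss_upto (real N) \<inter> R = {}" by (auto simp: gauss_upto_def R_def)
  have card: "real (card (gauss_upto (real (Suc N)))) = real (card (gauss_upto (real N))) + real (card R)"
    unfolding R using fin disj by (subst card_Un_disjoint) auto
  have "gauss_power_sum n (real (Suc N)) =
      gauss_power_sum n (real N) + (\<Sum>z\<in>R. gauss_norm z ^ n)"
    unfolding gauss_power_sum_def R using fin disj by (intro sum.union_disjoint) auto
  also have "(\<Sum>z\<in>R. gauss_norm z ^ n) = real (card R) * real (Suc N) ^ n"
    by (simp add: R_def)
  finally have S: "gauss_power_sum n (real (Suc N)) =
      gauss_power_sum n (real N) + real (card R) * real (Suc N) ^ n" .
  define e where "e = real (card (gauss_upto (real N))) - pi * real N"
  have e: "\<bar>e\<bar> \<le> B" unfolding e_def using Suc.prems by simp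
  have mono: "real N ^ n \<le> real (Suc N) ^ n" by (rule power_mono) auto
  have IH: "\<bar>gauss_power_sum n (real N) - pi * (\<Sum>m=1..N. real m ^ n) - e * real N ^ n\<bar>
      \<le> B * real N ^ n"
    unfolding e_def using Suc by simp
  \<comment> \<open>Passing from \<open>N\<close> to \<open>Suc N\<close> changes the remainder by
    the old counting error \<open>e\<close> times the increment of the n-th power. Bounding
    \<open>e\<close> by \<open>B\<close> makes these changes telescope to
    \<open>B * real (Suc N) ^ n\<close>.\<close>
  have "\<bar>e * (real (Suc N) ^ n - real N ^ n)\<bar> \<le> B * (real (Suc N) ^ n - real N ^ n)"
    unfolding abs_mult using e mono by (simp add: mult_right_mono)
  moreover have "gauss_power_sum n (real (Suc N)) - pi * (\<Sum>m=1..Suc N. real m ^ n)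
       - (real (card (gauss_upto (real (Suc N)))) - pi * real (Suc N)) * real (Suc N) ^ n =
     (gauss_power_sum n (real N) - pi * (\<Sum>m=1..N. real m ^ n) - e * real N ^ n)
       - e * (real (Suc N) ^ n - real N ^ n)"
    unfolding S card by (simp add: e_def algebra_simps)
  ultimately show ?case using IH by (simp only: right_diff_distrib)
qed

text \<open>The difference of powers factors into a sum of \<open>Suc n\<close> products of total
  degree \<open>n\<close> in \<open>N\<close> and \<open>Suc N\<close>, each lying between the two
  n-th powers.\<close>

lemma Suc_power_diff_bounds:
  "real (Suc n) * real N ^ n \<le> real (Suc N) ^ Suc n - real N ^ Suc n"
  "real (Suc N) ^ Suc n - real N ^ Suc n \<le> real (Suc n) * real (Suc N) ^ n"
proof -
  have eq: "real (Suc N) ^ Suc n - real N ^ Suc n =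
      (\<Sum>p<Suc n. real (Suc N) ^ p * real N ^ (n - p))"
    by (subst power_diff_sumr2) (simp add: mult.commute)
  have "real N ^ n \<le> real (Suc N) ^ p * real N ^ (n - p)" if "p \<in> {..<Suc n}" for p
  proof -
    have "real N ^ n = real N ^ p * real N ^ (n - p)"
      using that by (simp flip: power_add)
    also have "\<dots> \<le> real (Suc N) ^ p * real N ^ (n - p)"
      by (intro mult_right_mono power_mono) simp_all
    finally show ?thesis .
  qed
  from sum_bounded_below[of "{..<Suc n}", OF this]
  show "real (Suc n) * real N ^ n \<le> real (Suc N) ^ Suc n - real N ^ Suc n"
    unfolding eq card_lessThan .
  have "real (Suc N) ^ p * real N ^ (n - p) \<le> real (Suc N) ^ n" if "p \<in> {..<Suc n}" for p
  proof -
    have "real (Suc N) ^ p * real N ^ (n - p) \<le> real (Suc N) ^ p * real (Suc N) ^ (n - p)"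
      by (intro mult_left_mono power_mono) simp_all
    also have "\<dots> = real (Suc N) ^ n"
      using that by (simp flip: power_add del: of_nat_Suc)
    finally show ?thesis .
  qed
  from sum_bounded_above[of "{..<Suc n}", OF this]
  show "real (Suc N) ^ Suc n - real N ^ Suc n \<le> real (Suc n) * real (Suc N) ^ n"
    unfolding eq card_lessThan .
qed

text \<open>Both bounds telescope \<open>Suc_power_diff_bounds\<close>. The upper one carries an
  extra n-th power because the increment is bounded below by the power at the old endpoint, while
  the sum gains the power at the new one.\<close>

lemma sum_powers_bounds:
  "real N ^ Suc n \<le> real (Suc n) * (\<Sum>m=1..N. real m ^ n)"
  "real (Suc n) * (\<Sum>m=1..N. real m ^ n) \<le> real N ^ Suc n + real (Suc n) * real N ^ n"
proof (induction N)
  case (Suc N)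
  have step: "real (Suc n) * (\<Sum>m=1..Suc N. real m ^ n) =
      real (Suc n) * (\<Sum>m=1..N. real m ^ n) + real (Suc n) * real (Suc N) ^ n"
    by (simp add: algebra_simps)
  {
    case 1
    show ?case using Suc(1) Suc_power_diff_bounds(2)[of N n] unfolding step by linarith
  next
    case 2
    show ?case using Suc(2) Suc_power_diff_bounds(1)[of n N] unfolding step by linarith
  }
qed auto

text \<open>Along integers \<open>N\<close>, summation by parts replaces the sum by
  \<open>pi\<close> times the sum of the \<open>m ^ n\<close>, with an error of order
  \<open>sqrt N * N ^ n\<close>, which is negligible against \<open>N ^ Suc n\<close>. Rounding down
  then handles real \<open>x\<close>.\<close>

lemma gauss_power_sum_tendsto:
  "((\<lambda>x. gauss_power_sum n x / x ^ Suc n) \<longlongrightarrow> pi / real (Suc n)) at_top"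
proof -
  define C where "C = (2 * sqrt 2 + 2) * pi"
  have C: "C > 0" unfolding C_def by (intro mult_pos_pos add_pos_pos) auto
  define f where "f N = gauss_power_sum n (real N) / real N ^ Suc n" for N :: nat
  have "f \<longlonglongrightarrow> pi / real (Suc n)"
  proof (rule LIM_zero_cancel, rule Lim_null_comparison)
    show "\<forall>\<^sub>F N in sequentially. norm (f N - pi / real (Suc n)) \<le>
        2 * C / sqrt (real N) + pi / real N"
      using eventually_ge_at_top[of 1]
    proof eventually_elim
      case (elim N)
      define T where "T = (\<Sum>m=1..N. real m ^ n)"
      \<comment> \<open>One bound for all \<open>m \<le> N\<close>, as summation by parts requires.
        The index 0 is separate because \<open>card_gauss_upto_approx\<close> starts at 1.\<close>
      have bound: "\<bar>real (card (gauss_upto (real m))) - pi * real m\<bar> \<le> C * sqrt (real N)"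
        if "m \<le> N" for m
      proof (cases "m = 0")
        case False
        then have "\<bar>real (card (gauss_upto (real m))) - pi * real m\<bar> \<le> C * sqrt (real m)"
          unfolding C_def by (intro card_gauss_upto_approx) auto
        also have "\<dots> \<le> C * sqrt (real N)" using that C by (intro mult_left_mono) auto
        finally show ?thesis .
      qed (use C in \<open>simp add: gauss_upto_empty\<close>)
      have "\<bar>gauss_power_sum n (real N) - pi * T
           - (real (card (gauss_upto (real N))) - pi * real N) * real N ^ n\<bar>
          \<le> C * sqrt (real N) * real N ^ n"
        unfolding T_def by (rule gauss_power_sum_by_parts[OF bound])
      \<comment> \<open>The boundary term of the summation by parts obeys the same bound as the
        remainder, whence the factor 2 below.\<close>
      moreover have "\<bar>(real (card (gauss_upto (real N))) - pi * real N) * real N ^ n\<bar>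
          \<le> C * sqrt (real N) * real N ^ n"
        using bound[of N] by (simp add: abs_mult mult_right_mono)
      ultimately have 1: "\<bar>gauss_power_sum n (real N) - pi * T\<bar> \<le> 2 * C * sqrt (real N) * real N ^ n"
        by linarith
      have 2: "\<bar>T - real N ^ Suc n / real (Suc n)\<bar> \<le> real N ^ n"
        using sum_powers_bounds[where N = N and n = n] unfolding T_def[symmetric]
        by (simp add: field_simps abs_le_iff)
      have "\<bar>pi * T - pi * (real N ^ Suc n / real (Suc n))\<bar> \<le> pi * real N ^ n"
        unfolding right_diff_distrib[symmetric] abs_mult using 2 by simp
      with 1 have 3: "\<bar>gauss_power_sum n (real N) - pi * (real N ^ Suc n / real (Suc n))\<bar>
          \<le> 2 * C * sqrt (real N) * real N ^ n + pi * real N ^ n"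
        by linarith
      have "norm (f N - pi / real (Suc n)) =
          \<bar>gauss_power_sum n (real N) - pi * (real N ^ Suc n / real (Suc n))\<bar> / real N ^ Suc n"
      proof -
        have "f N - pi / real (Suc n) =
          (gauss_power_sum n (real N) - pi * (real N ^ Suc n / real (Suc n))) / real N ^ Suc n"
          using elim by (simp add: f_def diff_divide_distrib)
        then show ?thesis by (simp add: abs_divide)
      qed
      also have "\<dots> \<le> (2 * C * sqrt (real N) * real N ^ n + pi * real N ^ n) / real N ^ Suc n"
        by (intro divide_right_mono 3) auto
      also have "\<dots> = 2 * C * (sqrt (real N) / real N) + pi / real N"
        using elim by (simp add: add_divide_distrib)
      also have "sqrt (real N) / real N = 1 / sqrt (real N)"
        using elim by (simp add: field_simps)
      finally show ?case by simp
    qed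
    have "(\<lambda>N. 2 * C / sqrt (real N)) \<longlonglongrightarrow> 0"
      by (intro tendsto_divide_0[OF tendsto_const] filterlim_at_top_imp_at_infinity
          filterlim_compose[OF sqrt_at_top] filterlim_real_sequentially)
    moreover have "(\<lambda>N. pi / real N) \<longlonglongrightarrow> 0"
      by (rule lim_const_over_n)
    ultimately show "(\<lambda>N. 2 * C / sqrt (real N) + pi / real N) \<longlonglongrightarrow> 0"
      using tendsto_add by fastforce
  qed
  \<comment> \<open>From integers to reals: the power sum at \<open>x\<close> equals that at its
    integer part, and the ratio of the denominators tends to 1.\<close>
  then have "((\<lambda>x::real. f (nat \<lfloor>x\<rfloor>)) \<longlongrightarrow> pi / real (Suc n)) at_top"
    by (rule filterlim_compose)
      (rule filterlim_compose[OF filterlim_nat_sequentially filterlim_floor_sequentially])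
  moreover have "((\<lambda>x::real. (real (nat \<lfloor>x\<rfloor>) / x) ^ Suc n) \<longlongrightarrow> 1 ^ Suc n) at_top"
  proof (rule tendsto_power, rule LIM_zero_cancel, rule Lim_null_comparison)
    show "\<forall>\<^sub>F x::real in at_top. norm (real (nat \<lfloor>x\<rfloor>) / x - 1) \<le> inverse x"
      using eventually_ge_at_top[of 1]
    proof eventually_elim
      case (elim x)
      have "real (nat \<lfloor>x\<rfloor>) / x - 1 = (real_of_int \<lfloor>x\<rfloor> - x) / x"
        using elim by (simp add: field_simps)
      moreover have "\<bar>real_of_int \<lfloor>x\<rfloor> - x\<bar> / x \<le> 1 / x"
        using elim by (intro divide_right_mono) linarith+
      ultimately show ?case using elim by (simp add: abs_divide inverse_eq_divide)
    qed
    show "(inverse \<longlongrightarrow> (0::real)) at_top" by (rule tendsto_inverse_0_at_top) (rule filterlim_ident)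
  qed
  ultimately have "((\<lambda>x::real. f (nat \<lfloor>x\<rfloor>) * (real (nat \<lfloor>x\<rfloor>) / x) ^ Suc n)
      \<longlongrightarrow> pi / real (Suc n) * 1 ^ Suc n) at_top"
    by (rule tendsto_mult)
  moreover have "\<forall>\<^sub>F x::real in at_top.
      f (nat \<lfloor>x\<rfloor>) * (real (nat \<lfloor>x\<rfloor>) / x) ^ Suc n = gauss_power_sum n x / x ^ Suc n"
    using eventually_ge_at_top[of 1]
  proof eventually_elim
    case (elim x)
    then have "gauss_power_sum n (real (nat \<lfloor>x\<rfloor>)) = gauss_power_sum n x"
      unfolding gauss_power_sum_def by (subst gauss_upto_floor) auto
    moreover have "\<lfloor>x\<rfloor> \<noteq> 0" using elim by linarith
    ultimately show ?case using elim by (simp add: f_def power_divide)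
  qed
  ultimately show ?thesis
    by (simp add: filterlim_cong del: power_Suc)
qed

subsection \<open>Ideals and generators\<close>

abbreviation principal :: "complex \<Rightarrow> complex set" where
  "principal z \<equiv> PIdl\<^bsub>gauss_ring\<^esub> z"

lemma mem_principal: "w \<in> principal z \<longleftrightarrow> (\<exists>u\<in>Zi. w = u * z)"
  by (auto simp: cgenideal_def)

lemma principal_1: "principal 1 = Zi"
  by (auto simp: mem_principal)

lemma principal_0: "principal 0 = {0}"
  unfolding mem_principal set_eq_iff by (metis Zi_closed(1) mult_zero_right singleton_iff)

lemma principal_subset_iff:
  assumes "z \<in> Zi"
  shows "principal z \<subseteq> principal w \<longleftrightarrow> z \<in> principal w"
proof
  assume "z \<in> principal w"
  then show "principal z \<subseteq> principal w"
    by (auto simp: mem_principal) (metis Zi_closed(5) mult.assoc)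
qed (use gauss.cgenideal_self[OF assms] in auto)

lemma gauss_norm_eq_1:
  assumes "u \<in> Zi" "gauss_norm u = 1"
  shows "u \<in> {1, -1, \<i>, -\<i>}"
proof -
  obtain a b where u: "u = Complex (of_int a) (of_int b)"
    using assms(1) by (auto simp: gauss_ring_def)
  have "real_of_int (a\<^sup>2 + b\<^sup>2) = 1" using assms(2) by (simp add: u gauss_norm_def)
  then have *: "a\<^sup>2 + b\<^sup>2 = 1" by linarith
  then have "a\<^sup>2 \<le> 1" "b\<^sup>2 \<le> 1"
    using zero_le_power2[of a] zero_le_power2[of b] by linarith+
  then have "\<bar>a\<bar> \<le> 1" "\<bar>b\<bar> \<le> 1"
    by (simp_all add: abs_square_le_1)
  then have "a \<in> {-1, 0, 1}" "b \<in> {-1, 0, 1}" by auto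
  then show ?thesis using * by (auto simp: u complex_eq_iff)
qed

text \<open>Generators of the same nonzero ideal divide each other, so they differ by an element of
  norm 1, and these are the four units.\<close>

lemma card_generators:
  assumes "z \<in> Zi" "z \<noteq> 0"
  shows "card {w \<in> Zi. principal w = principal z} = 4"
proof -
  have "{w \<in> Zi. principal w = principal z} = (\<lambda>u. u * z) ` {1, -1, \<i>, -\<i>}"
  proof (intro equalityI subsetI)
    fix w assume w: "w \<in> {w \<in> Zi. principal w = principal z}"
    then have "w \<in> principal z" "z \<in> principal w"
      using principal_subset_iff[of w z] principal_subset_iff[of z w] assms by auto
    then obtain u v where u: "u \<in> Zi" "w = u * z" and v: "v \<in> Zi" "z = v * w"
      unfolding mem_principal by blast
    have "w \<noteq> 0" using v assms by auto
    have "gauss_norm u \<ge> 1" "gauss_norm v \<ge> 1"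
      using u v assms \<open>w \<noteq> 0\<close> by (auto intro!: gauss_norm_ge_1)
    moreover have "gauss_norm u * gauss_norm v = 1"
    proof -
      have "(u * v) * z = 1 * z" using u v by (metis mult.assoc mult.commute mult_1)
      then have "u * v = 1" using assms by simp
      then show ?thesis unfolding gauss_norm_mult[symmetric] by (simp add: gauss_norm_def)
    qed
    ultimately have "gauss_norm u = 1"
      using mult_left_mono[of 1 "gauss_norm v" "gauss_norm u"] by simp
    then show "w \<in> (\<lambda>u. u * z) ` {1, -1, \<i>, -\<i>}"
      using gauss_norm_eq_1 u by blast
  next
    fix w assume "w \<in> (\<lambda>u. u * z) ` {1, -1, \<i>, -\<i>}"
    then obtain u where u: "w = u * z" "u \<in> {1, -1, \<i>, -\<i>}" by blast
    \<comment> \<open>The inverse of a number of modulus 1 is its conjugate.\<close>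
    define v where "v = cnj u"
    have uv: "w = u * z" "u \<in> Zi" "v \<in> Zi" "v * u = 1"
      using u by (auto simp: v_def)
    then have w: "w \<in> Zi" using assms by auto
    have "z = v * w" using uv by (simp flip: mult.assoc)
    then have "w \<in> principal z" "z \<in> principal w"
      using uv by (auto simp: mem_principal)
    then show "w \<in> {w \<in> Zi. principal w = principal z}"
      using principal_subset_iff[of w z] principal_subset_iff[of z w] assms w by auto
  qed
  moreover have "inj_on (\<lambda>u. u * z) {1, -1, \<i>, -\<i>}"
    using assms by (intro inj_onI) simp
  moreover have "card {1, -1, \<i>, -\<i>} = 4"
    by (simp add: complex_eq_iff)
  ultimately show ?thesis by (metis card_image)
qed

section \<open>Greatest common divisors in terms of generators\<close>

definition gauss_gcd :: "complex \<Rightarrow> complex \<Rightarrow> complex set" where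
  "gauss_gcd z w = ideal_gcd (principal z) (principal w)"

definition gauss_coprime :: "complex \<Rightarrow> complex \<Rightarrow> bool" where
  "gauss_coprime z w \<longleftrightarrow> gauss_gcd z w = principal 1"

text \<open>Bezout: the ideal generated by the union of two ideals is their sum.\<close>

lemma mem_gauss_gcd:
  assumes "z \<in> Zi" "w \<in> Zi"
  shows "t \<in> gauss_gcd z w \<longleftrightarrow> (\<exists>u\<in>Zi. \<exists>v\<in>Zi. t = u * z + v * w)"
proof -
  have "gauss_gcd z w = principal z <+>\<^bsub>gauss_ring\<^esub> principal w"
    unfolding gauss_gcd_def ideal_gcd_def
    using assms by (intro gauss.union_genideal gauss.cgenideal_ideal)
  moreover have "t \<in> principal z <+>\<^bsub>gauss_ring\<^esub> principal w \<longleftrightarrow>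
      (\<exists>x\<in>principal z. \<exists>y\<in>principal w. t = x + y)"
    by (auto simp: set_add_def')
  ultimately show ?thesis unfolding Bex_def mem_principal by blast
qed

lemma gauss_gcd_principal:
  assumes "z \<in> Zi" "w \<in> Zi" "z \<noteq> 0"
  obtains k where "k \<in> Zi" "k \<noteq> 0" "gauss_gcd z w = principal k"
proof -
  have "ideal (gauss_gcd z w) gauss_ring"
    unfolding gauss_gcd_def using assms
    by (intro ideal_gcd_smallest(1) gauss.cgenideal_ideal)
  then obtain k where k: "k \<in> Zi" "gauss_gcd z w = principal k"
    using principal_domain.exists_gen[OF principal_domain_gauss_ring] by blast
  have "z = 1 * z + 0 * w" by simp
  then have "z \<in> gauss_gcd z w"
    unfolding mem_gauss_gcd[OF assms(1,2)] by (intro bexI[of _ 1] bexI[of _ 0]) auto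
  then have "k \<noteq> 0" using assms(3) k by (auto simp: mem_principal)
  with k show ?thesis using that by blast
qed

text \<open>Multiplication by \<open>k\<close> carries \<open>gauss_gcd a b\<close> onto the gcd of
  the multiples and \<open>principal 1\<close> onto \<open>principal k\<close>. For
  \<open>k \<noteq> 0\<close> it is injective, so it can be cancelled from an equation of
  sets.\<close>

lemma gauss_gcd_mult_eq_iff:
  assumes "k \<in> Zi" "k \<noteq> 0" "a \<in> Zi" "b \<in> Zi"
  shows "gauss_gcd (k * a) (k * b) = principal k \<longleftrightarrow> gauss_coprime a b"
proof -
  have "gauss_gcd (k * a) (k * b) = (*) k ` gauss_gcd a b"
  proof (rule Set.set_eqI)
    fix t
    have "u * (k * a) + v * (k * b) = k * (u * a + v * b)" for u v
      by (simp add: algebra_simps)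
    then show "t \<in> gauss_gcd (k * a) (k * b) \<longleftrightarrow> t \<in> (*) k ` gauss_gcd a b"
      using assms by (simp add: mem_gauss_gcd image_iff Bex_def) blast
  qed
  moreover have "principal k = (*) k ` principal 1"
    by (auto simp: principal_1 mem_principal image_iff mult.commute)
  moreover have "inj ((*) k)" using assms(2) by (simp add: inj_def)
  ultimately show ?thesis by (simp add: gauss_coprime_def inj_image_eq_iff)
qed

lemma gauss_gcd_factors:
  assumes "k \<in> Zi" "z \<in> Zi" "w \<in> Zi" "gauss_gcd z w = principal k"
  obtains a b where "a \<in> Zi" "b \<in> Zi" "z = k * a" "w = k * b"
proof -
  have "z = 1 * z + 0 * w" "w = 0 * z + 1 * w" by simp_all
  then have "z \<in> gauss_gcd z w" "w \<in> gauss_gcd z w"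
    unfolding mem_gauss_gcd[OF assms(2,3)] by (meson Zi_closed)+
  then show ?thesis using that assms(4) by (auto simp: mem_principal mult.commute)
qed

lemma ideals_upto_eq: "ideals_upto x = principal ` gauss_upto x"
proof (intro equalityI subsetI)
  fix I assume I: "I \<in> ideals_upto x"
  then obtain z where z: "z \<in> Zi" "I = principal z"
    using principal_domain.exists_gen[OF principal_domain_gauss_ring] by (auto simp: ideals_upto_def)
  moreover have "z \<noteq> 0" using I z principal_0 by (auto simp: ideals_upto_def)
  ultimately have "z \<in> gauss_upto x"
    using I by (simp add: ideals_upto_def gauss_upto_def ideal_norm_PIdl)
  with z show "I \<in> principal ` gauss_upto x" by blast
next
  fix I assume "I \<in> principal ` gauss_upto x"
  then obtain z where z: "z \<in> Zi" "z \<noteq> 0" "gauss_norm z \<le> x" "I = principal z"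
    by (auto simp: gauss_upto_def)
  moreover have "z \<in> principal z" using z by (simp add: gauss.cgenideal_self)
  ultimately show "I \<in> ideals_upto x"
    by (auto simp: ideals_upto_def ideal_norm_PIdl intro: gauss.cgenideal_ideal)
qed

text \<open>Group the points by the ideal they generate. All generators of an ideal share its norm,
  so the cutoff \<open>x\<close> keeps either all four of them or none.\<close>

lemma sum_gauss_upto_principal:
  "(\<Sum>z\<in>gauss_upto x. f (principal z)) = 4 * (\<Sum>I\<in>ideals_upto x. f I :: real)"
proof -
  have "(\<Sum>z\<in>gauss_upto x. f (principal z)) =
      (\<Sum>I\<in>ideals_upto x. \<Sum>z | z \<in> gauss_upto x \<and> principal z = I. f (principal z))"
    by (intro sum.group[symmetric]) (auto simp: finite_ideals_upto ideals_upto_eq)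
  also have "\<dots> = (\<Sum>I\<in>ideals_upto x. 4 * f I)"
  proof (intro sum.cong refl)
    fix I assume "I \<in> ideals_upto x"
    then obtain w where w: "w \<in> Zi" "w \<noteq> 0" "gauss_norm w \<le> x" "I = principal w"
      by (auto simp: ideals_upto_eq gauss_upto_def)
    have "{z. z \<in> gauss_upto x \<and> principal z = I} = {z \<in> Zi. principal z = principal w}"
    proof -
      have "z \<noteq> 0 \<and> gauss_norm z \<le> x" if "z \<in> Zi" "principal z = principal w" for z
      proof -
        have "gauss_norm z = gauss_norm w"
          using that w ideal_norm_PIdl by metis
        moreover have "gauss_norm w \<ge> 1" using w by (intro gauss_norm_ge_1)
        ultimately show ?thesis using w by (auto simp: gauss_norm_def)
      qed
      then show ?thesis using w by (auto simp: gauss_upto_def)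
    qed
    then have "card {z. z \<in> gauss_upto x \<and> principal z = I} = 4"
      using card_generators w by simp
    then show "(\<Sum>z | z \<in> gauss_upto x \<and> principal z = I. f (principal z)) = 4 * f I"
      by simp
  qed
  also have "\<dots> = 4 * (\<Sum>I\<in>ideals_upto x. f I)" by (simp add: sum_distrib_left)
  finally show ?thesis .
qed

text \<open>Two independent uniform choices are one uniform choice of a pair. Passing to generators
  multiplies the sum and the number of pairs alike by 16.\<close>

lemma gcd_moment_eq:
  assumes "x \<ge> 1"
  shows "gcd_moment x n =
    (\<Sum>(z, w)\<in>gauss_upto x \<times> gauss_upto x. ideal_norm (gauss_gcd z w) ^ n) /
      real (card (gauss_upto x)) ^ 2"
proof -
  let ?I = "ideals_upto x"
  have fin: "finite ?I" and ne: "?I \<noteq> {}"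
    using finite_ideals_upto ideals_upto_nonempty assms by auto
  have "pair_pmf (pmf_of_set ?I) (pmf_of_set ?I) = pmf_of_set (?I \<times> ?I)"
  proof (intro pmf_eqI)
    fix p show "pmf (pair_pmf (pmf_of_set ?I) (pmf_of_set ?I)) p = pmf (pmf_of_set (?I \<times> ?I)) p"
      using fin ne by (cases p) (simp add: pmf_pair indicator_def)
  qed
  then have "gcd_moment x n =
      (\<Sum>(I, J)\<in>?I \<times> ?I. ideal_norm (ideal_gcd I J) ^ n) / real (card ?I) ^ 2"
    unfolding gcd_moment_def using fin ne
    by (simp add: integral_pmf_of_set power2_eq_square card_cartesian_product)
  also have "(\<Sum>(I, J)\<in>?I \<times> ?I. ideal_norm (ideal_gcd I J) ^ n) =
      (\<Sum>(z, w)\<in>gauss_upto x \<times> gauss_upto x. ideal_norm (gauss_gcd z w) ^ n) / 16"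
  proof -
    have "(\<Sum>z\<in>gauss_upto x. \<Sum>w\<in>gauss_upto x. ideal_norm (gauss_gcd z w) ^ n) =
        (\<Sum>z\<in>gauss_upto x. 4 * (\<Sum>J\<in>?I. ideal_norm (ideal_gcd (principal z) J) ^ n))"
      unfolding gauss_gcd_def
      by (intro sum.cong refl sum_gauss_upto_principal[of "\<lambda>J. ideal_norm (ideal_gcd (principal _) J) ^ n"])
    also have "\<dots> = 4 * (\<Sum>I\<in>?I. 4 * (\<Sum>J\<in>?I. ideal_norm (ideal_gcd I J) ^ n))"
      by (rule sum_gauss_upto_principal)
    finally show ?thesis
      by (simp add: sum.cartesian_product[symmetric] flip: sum_distrib_left)
  qed
  also have "real (card ?I) = real (card (gauss_upto x)) / 4"
    using sum_gauss_upto_principal[of "\<lambda>_. 1" x] by simp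
  finally show ?thesis by (simp add: power2_eq_square)
qed

subsection \<open>Extracting the greatest common divisor\<close>

definition coprime_pairs :: "real \<Rightarrow> (complex \<times> complex) set" where
  "coprime_pairs x = {(a, b) \<in> gauss_upto x \<times> gauss_upto x. gauss_coprime a b}"

lemma sum_gcd_norm_eq:
  "4 * (\<Sum>(z, w)\<in>gauss_upto x \<times> gauss_upto x. ideal_norm (gauss_gcd z w) ^ n) =
    (\<Sum>(a, b)\<in>coprime_pairs x. gauss_power_sum n (x / max (gauss_norm a) (gauss_norm b)))"
proof -
  let ?L = "gauss_upto x"
  \<comment> \<open>\<open>K\<close> attaches to a pair the four generators of its gcd, which
    accounts for the factor 4. \<open>Q\<close> attaches to a coprime pair the multipliers that keep
    both multiples within norm \<open>x\<close>.\<close>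
  define K where "K = (\<lambda>(z, w). {k \<in> Zi. principal k = gauss_gcd z w})"
  define Q where "Q = (\<lambda>(a, b). gauss_upto (x / max (gauss_norm a) (gauss_norm b)))"
  have K: "card (K (z, w)) = 4" "\<forall>k\<in>K (z, w). gauss_norm k = ideal_norm (gauss_gcd z w)"
    if zw: "z \<in> ?L" "w \<in> ?L" for z w
  proof -
    obtain k where k: "k \<in> Zi" "k \<noteq> 0" "gauss_gcd z w = principal k"
      using gauss_gcd_principal[of z w] zw by (auto simp: gauss_upto_def)
    then show "card (K (z, w)) = 4" using card_generators[of k] by (simp add: K_def)
    show "\<forall>k\<in>K (z, w). gauss_norm k = ideal_norm (gauss_gcd z w)"
      by (auto simp: K_def ideal_norm_PIdl[symmetric])
  qed
  have finK: "finite (K p)" if "p \<in> ?L \<times> ?L" for p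
    using that K(1) by (cases p) (metis card.infinite mem_Sigma_iff zero_neq_numeral)
  have finC: "finite (coprime_pairs x)"
    unfolding coprime_pairs_def by (rule finite_subset[of _ "?L \<times> ?L"]) auto
  have "4 * (\<Sum>(z, w)\<in>?L \<times> ?L. ideal_norm (gauss_gcd z w) ^ n) =
      (\<Sum>p\<in>?L \<times> ?L. \<Sum>k\<in>K p. gauss_norm k ^ n)"
    unfolding sum_distrib_left
  proof (intro sum.cong refl)
    fix p assume "p \<in> ?L \<times> ?L"
    then obtain z w where p: "p = (z, w)" "z \<in> ?L" "w \<in> ?L" by auto
    have "(\<Sum>k\<in>K (z, w). gauss_norm k ^ n) = (\<Sum>k\<in>K (z, w). ideal_norm (gauss_gcd z w) ^ n)"
      using K(2)[OF p(2,3)] by (intro sum.cong) auto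
    then show "4 * (case p of (z, w) \<Rightarrow> ideal_norm (gauss_gcd z w) ^ n) =
        (\<Sum>k\<in>K p. gauss_norm k ^ n)"
      using K(1)[OF p(2,3)] p by simp
  qed
  also have "\<dots> = (\<Sum>(p, k)\<in>Sigma (?L \<times> ?L) K. gauss_norm k ^ n)"
    using finK by (intro sum.Sigma) auto
  also have "\<dots> = (\<Sum>(p, k)\<in>Sigma (coprime_pairs x) Q. gauss_norm k ^ n)"
  \<comment> \<open>Dividing a pair by a chosen generator of its gcd gives a coprime pair;
    multiplying by that generator undoes this. The summand depends only on \<open>k\<close>, which
    stays fixed.\<close>
  proof (rule sum.reindex_bij_witness
      [of _ "\<lambda>((a, b), k). ((k * a, k * b), k)" "\<lambda>((z, w), k). ((z / k, w / k), k)"])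
    fix s assume "s \<in> Sigma (?L \<times> ?L) K"
    then obtain z w k where s: "s = ((z, w), k)" "z \<in> ?L" "w \<in> ?L" "k \<in> Zi"
      "principal k = gauss_gcd z w" by (auto simp: K_def)
    have zw: "z \<in> Zi" "w \<in> Zi" "z \<noteq> 0" "w \<noteq> 0" using s by (auto simp: gauss_upto_def)
    obtain a b where ab: "a \<in> Zi" "b \<in> Zi" "z = k * a" "w = k * b"
      using gauss_gcd_factors[OF s(4) zw(1,2)] s(5) by metis
    have nz: "k \<noteq> 0" "a \<noteq> 0" "b \<noteq> 0" using ab zw by auto
    have cop: "gauss_coprime a b"
      using gauss_gcd_mult_eq_iff[of k a b] s(5) ab s(4) nz by simp
    have norms: "gauss_norm k \<ge> 1" "gauss_norm a \<ge> 1" "gauss_norm b \<ge> 1"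
      using s(4) ab nz by (auto intro!: gauss_norm_ge_1)
    have le: "gauss_norm k * gauss_norm a \<le> x" "gauss_norm k * gauss_norm b \<le> x"
      using s(2,3) ab by (auto simp: gauss_upto_def gauss_norm_mult)
    have "gauss_norm a \<le> x" "gauss_norm b \<le> x"
      using le mult_right_mono[OF norms(1) gauss_norm_nonneg[of a]]
        mult_right_mono[OF norms(1) gauss_norm_nonneg[of b]] by linarith+
    then have "(a, b) \<in> coprime_pairs x"
      using ab nz cop by (auto simp: coprime_pairs_def gauss_upto_def)
    moreover have "k \<in> Q (a, b)"
      using le norms nz s(4) by (auto simp: Q_def gauss_upto_def max_def field_simps)
    ultimately show "(\<lambda>((z, w), k). ((z / k, w / k), k)) s \<in> Sigma (coprime_pairs x) Q"
      using s ab nz by simp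
    show "(\<lambda>((a, b), k). ((k * a, k * b), k)) ((\<lambda>((z, w), k). ((z / k, w / k), k)) s) = s"
      using s nz by simp
    show "(case (\<lambda>((z, w), k). ((z / k, w / k), k)) s of (p, k) \<Rightarrow> gauss_norm k ^ n) =
        (case s of (p, k) \<Rightarrow> gauss_norm k ^ n)"
      using s by simp
  next
    fix s assume "s \<in> Sigma (coprime_pairs x) Q"
    then obtain a b k where s: "s = ((a, b), k)" "(a, b) \<in> coprime_pairs x" "k \<in> Q (a, b)"
      by auto
    have ab: "a \<in> Zi" "b \<in> Zi" "a \<noteq> 0" "b \<noteq> 0" "gauss_coprime a b"
      using s by (auto simp: coprime_pairs_def gauss_upto_def)
    have k: "k \<in> Zi" "k \<noteq> 0" "gauss_norm k \<le> x / max (gauss_norm a) (gauss_norm b)"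
      using s by (auto simp: Q_def gauss_upto_def)
    have "gauss_norm a \<ge> 1" using ab by (intro gauss_norm_ge_1)
    then have "gauss_norm k * max (gauss_norm a) (gauss_norm b) \<le> x"
      using k(3) by (simp add: pos_le_divide_eq less_max_iff_disj)
    moreover have "gauss_norm k * gauss_norm a \<le> gauss_norm k * max (gauss_norm a) (gauss_norm b)"
      "gauss_norm k * gauss_norm b \<le> gauss_norm k * max (gauss_norm a) (gauss_norm b)"
      by (intro mult_left_mono; simp)+
    ultimately have "k * a \<in> ?L" "k * b \<in> ?L"
      using ab k by (auto simp: gauss_upto_def gauss_norm_mult)
    moreover have "principal k = gauss_gcd (k * a) (k * b)"
      using gauss_gcd_mult_eq_iff[of k a b] ab k by simp
    ultimately show "(\<lambda>((a, b), k). ((k * a, k * b), k)) s \<in> Sigma (?L \<times> ?L) K"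
      using s k by (simp add: K_def)
    show "(\<lambda>((z, w), k). ((z / k, w / k), k)) ((\<lambda>((a, b), k). ((k * a, k * b), k)) s) = s"
      using s k by simp
  qed
  also have "\<dots> = (\<Sum>p\<in>coprime_pairs x. \<Sum>k\<in>Q p. gauss_norm k ^ n)"
    using finC by (intro sum.Sigma[symmetric]) (auto simp: Q_def)
  also have "\<dots> = (\<Sum>(a, b)\<in>coprime_pairs x. gauss_power_sum n (x / max (gauss_norm a) (gauss_norm b)))"
    by (simp add: Q_def gauss_power_sum_def case_prod_unfold)
  finally show ?thesis .
qed

section \<open>Coprime pairs sorted by their larger norm\<close>

definition coprime_layer :: "nat \<Rightarrow> (complex \<times> complex) set" where
  "coprime_layer m = {(a, b) \<in> coprime_pairs (real m). max (gauss_norm a) (gauss_norm b) = real m}"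

lemma finite_coprime_layer: "finite (coprime_layer m)"
  unfolding coprime_layer_def coprime_pairs_def
  by (rule finite_subset[of _ "gauss_upto (real m) \<times> gauss_upto (real m)"]) auto

text \<open>Coprimality is discarded; with the linear count of lattice points this gives layers of
  size O(m^2).\<close>

lemma card_coprime_layer_le: "card (coprime_layer m) \<le> card (gauss_upto (real m)) ^ 2"
proof -
  have "card (coprime_layer m) \<le> card (gauss_upto (real m) \<times> gauss_upto (real m))"
    by (rule card_mono) (auto simp: coprime_layer_def coprime_pairs_def)
  then show ?thesis by (simp add: card_cartesian_product power2_eq_square)
qed

text \<open>Supplies the positive term that keeps the leading constant of the moment from
  vanishing.\<close>

lemma coprime_layer_1_nonempty: "coprime_layer 1 \<noteq> {}"
proof -
  have "gauss_coprime 1 1"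
    unfolding gauss_coprime_def
  proof (rule Set.set_eqI)
    show "t \<in> gauss_gcd 1 1 \<longleftrightarrow> t \<in> principal 1" for t
      by (auto simp: mem_gauss_gcd mem_principal intro: bexI[of _ t] bexI[of _ 0])
  qed
  then have "(1, 1) \<in> coprime_layer 1"
    by (simp add: coprime_layer_def coprime_pairs_def gauss_upto_def gauss_norm_def)
  then show ?thesis by blast
qed

lemma coprime_pairs_eq_UN:
  "coprime_pairs x = (\<Union>m\<in>{..nat \<lfloor>x\<rfloor>}. coprime_layer m)"
proof (intro equalityI subsetI)
  fix p assume "p \<in> coprime_pairs x"
  then obtain a b where p: "p = (a, b)" "a \<in> gauss_upto x" "b \<in> gauss_upto x" "gauss_coprime a b"
    by (auto simp: coprime_pairs_def)
  define M where "M = max (gauss_norm a) (gauss_norm b)"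
  have "M \<in> \<int>"
    using p gauss_norm_Ints by (auto simp: M_def max_def gauss_upto_def)
  moreover have "M \<ge> 0" by (simp add: M_def le_max_iff_disj)
  ultimately obtain m where m: "M = real m"
    by (metis Ints_cases nat_0_le of_int_0_le_iff of_int_of_nat_eq)
  have "M \<le> x" using p by (auto simp: M_def gauss_upto_def)
  then have "m \<le> nat \<lfloor>x\<rfloor>" using m by (simp add: le_nat_floor)
  moreover have "gauss_norm a \<le> M" "gauss_norm b \<le> M" by (simp_all add: M_def)
  then have "p \<in> coprime_layer m"
    using p m by (auto simp: coprime_layer_def coprime_pairs_def gauss_upto_def M_def)
  ultimately show "p \<in> (\<Union>m\<in>{..nat \<lfloor>x\<rfloor>}. coprime_layer m)" by blast
next
  fix p assume "p \<in> (\<Union>m\<in>{..nat \<lfloor>x\<rfloor>}. coprime_layer m)"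
  then obtain m a b where m: "m \<le> nat \<lfloor>x\<rfloor>" "p = (a, b)" "(a, b) \<in> coprime_layer m" by (cases p) auto
  have ab: "a \<in> Zi" "a \<noteq> 0" "b \<in> Zi" "b \<noteq> 0" "gauss_coprime a b"
    "gauss_norm a \<le> real m" "gauss_norm b \<le> real m"
    using m by (auto simp: coprime_layer_def coprime_pairs_def gauss_upto_def)
  \<comment> \<open>For negative \<open>x\<close> the index 0 still lies in the range, as
    \<open>nat\<close> truncates. Having \<open>m \<ge> 1\<close> excludes that case and turns the
    bound on \<open>m\<close> into \<open>real m \<le> x\<close>.\<close>
  have "gauss_norm a \<ge> 1" using ab by (intro gauss_norm_ge_1)
  then have "m \<ge> 1" using ab by linarith
  then have "real m \<le> x" using m(1) by linarith
  then show "p \<in> coprime_pairs x" using ab m by (auto simp: coprime_pairs_def gauss_upto_def)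
qed

lemma sum_coprime_pairs_layers:
  "(\<Sum>(a, b)\<in>coprime_pairs x. gauss_power_sum n (x / max (gauss_norm a) (gauss_norm b))) =
    (\<Sum>m. real (card (coprime_layer m)) * gauss_power_sum n (x / real m))"
proof -
  have "(\<Sum>(a, b)\<in>coprime_pairs x. gauss_power_sum n (x / max (gauss_norm a) (gauss_norm b))) =
      (\<Sum>m\<le>nat \<lfloor>x\<rfloor>. \<Sum>(a, b)\<in>coprime_layer m. gauss_power_sum n (x / max (gauss_norm a) (gauss_norm b)))"
    unfolding coprime_pairs_eq_UN
    by (intro sum.UNION_disjoint) (auto simp: finite_coprime_layer, auto simp: coprime_layer_def)
  also have "\<dots> = (\<Sum>m\<le>nat \<lfloor>x\<rfloor>. real (card (coprime_layer m)) * gauss_power_sum n (x / real m))"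
  proof (intro sum.cong refl)
    fix m
    have "(\<Sum>(a, b)\<in>coprime_layer m. gauss_power_sum n (x / max (gauss_norm a) (gauss_norm b))) =
        (\<Sum>p\<in>coprime_layer m. gauss_power_sum n (x / real m))"
      by (intro sum.cong) (auto simp: coprime_layer_def)
    then show "(\<Sum>(a, b)\<in>coprime_layer m. gauss_power_sum n (x / max (gauss_norm a) (gauss_norm b))) =
        real (card (coprime_layer m)) * gauss_power_sum n (x / real m)" by simp
  qed
  \<comment> \<open>Beyond \<open>x\<close> the argument \<open>x / real m\<close> drops below 1 and
    the power sum is empty. Writing an infinite series makes the index range independent of
    \<open>x\<close>.\<close>
  also have "\<dots> = (\<Sum>m. real (card (coprime_layer m)) * gauss_power_sum n (x / real m))"
  proof (intro suminf_finite[symmetric])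
    fix m assume "m \<notin> {..nat \<lfloor>x\<rfloor>}"
    then have "x < real m" "m > 0" by (simp_all add: not_le) linarith
    then have "x / real m < 1" by simp
    then show "real (card (coprime_layer m)) * gauss_power_sum n (x / real m) = 0"
      by (simp add: gauss_power_sum_def gauss_upto_empty)
  qed simp
  finally show ?thesis .
qed

lemma coprime_layer_0: "coprime_layer 0 = {}"
  by (simp add: coprime_layer_def coprime_pairs_def gauss_upto_empty)

text \<open>Dominated convergence for series (Tannery): after division by \<open>x ^ Suc n\<close>
  each term converges by \<open>gauss_power_sum_tendsto\<close>, and all are dominated by a multiple
  of the series of \<open>1 / m^2\<close>.\<close>

lemma coprime_layer_series_tendsto:
  assumes "n > 2"
  shows "((\<lambda>x. (\<Sum>m. real (card (coprime_layer m)) * gauss_power_sum n (x / real m)) / x ^ Suc n)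
      \<longlongrightarrow> pi / real (Suc n) * (\<Sum>m. real (card (coprime_layer m)) / real m ^ Suc n)) at_top"
    and "summable (\<lambda>m. real (card (coprime_layer m)) / real m ^ Suc n)"
proof -
  define g where "g m = real (card (coprime_layer m))" for m
  obtain C where C: "C > 0" "\<And>x. x \<ge> 0 \<Longrightarrow> real (card (gauss_upto x)) \<le> C * x"
    using card_gauss_upto_le by blast
  obtain D where D: "D > 0" "\<And>x. x \<ge> 0 \<Longrightarrow> gauss_power_sum n x \<le> D * x ^ Suc n"
    using gauss_power_sum_le by blast
  \<comment> \<open>Index 0 is treated apart below, because division by \<open>real m\<close> there
    only has the default value 0.\<close>
  have g0: "g 0 = 0" by (simp add: g_def coprime_layer_0)
  have g: "g m \<le> C\<^sup>2 * real m ^ 2" for m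
  proof -
    have "g m \<le> real (card (gauss_upto (real m))) ^ 2"
      unfolding g_def using card_coprime_layer_le[of m] by (simp flip: of_nat_power)
    also have "\<dots> \<le> (C * real m) ^ 2" by (intro power_mono C) auto
    finally show ?thesis by (simp add: power_mult_distrib)
  qed
  have gs: "g m / real m ^ Suc n \<le> C\<^sup>2 * inverse (real m ^ 2)" for m
  proof (cases "m = 0")
    case False
    then have "g m / real m ^ Suc n \<le> C\<^sup>2 * real m ^ 2 / real m ^ Suc n"
      by (intro divide_right_mono g) auto
    \<comment> \<open>The assumption \<open>n > 2\<close> enters here: \<open>Suc n\<close> is at
      least 4, so the quadratic layer size leaves a summable inverse square.\<close>
    also have "\<dots> \<le> C\<^sup>2 * real m ^ 2 / real m ^ 4"
      using False assms by (intro divide_left_mono power_increasing) auto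
    also have "\<dots> = C\<^sup>2 * inverse (real m ^ 2)"
      using False by (simp add: field_simps power2_eq_square power4_eq_xxxx)
    finally show ?thesis .
  qed (simp add: g0)
  have sq: "summable (\<lambda>m. inverse (real m ^ 2))"
    by (rule inverse_power_summable) simp
  define a where "a m x = g m * gauss_power_sum n (x / real m) / x ^ Suc n" for m and x :: real
  have bound: "norm (a m x) \<le> D * (C\<^sup>2 * inverse (real m ^ 2))" if "x > 0" for m x
  proof (cases "m = 0")
    case False
    have "norm (a m x) = g m * gauss_power_sum n (x / real m) / x ^ Suc n"
      using that by (simp add: a_def g_def abs_mult)
    also have "\<dots> \<le> g m * (D * (x / real m) ^ Suc n) / x ^ Suc n"
      using that by (intro divide_right_mono mult_left_mono D) (auto simp: g_def)
    also have "\<dots> = D * (g m / real m ^ Suc n)"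
      using that by (simp add: power_divide)
    also have "\<dots> \<le> D * (C\<^sup>2 * inverse (real m ^ 2))"
      using D(1) gs by (intro mult_left_mono) auto
    finally show ?thesis .
  qed (simp add: a_def g0)
  have lim: "((\<lambda>x. a m x) \<longlongrightarrow> pi / real (Suc n) * (g m / real m ^ Suc n)) at_top" for m
  proof (cases "m = 0")
    case False
    have "filterlim (\<lambda>x::real. x / real m) at_top at_top"
      using filterlim_tendsto_pos_mult_at_top[OF tendsto_const[of "1 / real m"] _ filterlim_ident] False
      by simp
    then have "((\<lambda>x. gauss_power_sum n (x / real m) / (x / real m) ^ Suc n)
        \<longlongrightarrow> pi / real (Suc n)) at_top"
      by (rule filterlim_compose[OF gauss_power_sum_tendsto])
    then have "((\<lambda>x. gauss_power_sum n (x / real m) / (x / real m) ^ Suc n * (g m / real m ^ Suc n))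
        \<longlongrightarrow> pi / real (Suc n) * (g m / real m ^ Suc n)) at_top"
      by (rule tendsto_mult_right)
    moreover have "gauss_power_sum n (x / real m) / (x / real m) ^ Suc n * (g m / real m ^ Suc n)
        = a m x" for x
      using False by (simp add: a_def power_divide)
    ultimately show ?thesis by simp
  qed (simp add: a_def g0)
  have T: "eventually (\<lambda>x. summable (\<lambda>m. norm (a m x))) at_top \<and>
      summable (\<lambda>m. norm (pi / real (Suc n) * (g m / real m ^ Suc n))) \<and>
      ((\<lambda>x. \<Sum>m. a m x) \<longlongrightarrow> (\<Sum>m. pi / real (Suc n) * (g m / real m ^ Suc n))) at_top"
  proof (rule tannerys_theorem[OF lim])
    show "summable (\<lambda>m. D * (C\<^sup>2 * inverse (real m ^ 2)))"
      by (intro summable_mult sq)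
    have "\<forall>\<^sub>F p in at_top \<times>\<^sub>F at_top. (snd p :: real) > 0"
      by (rule eventually_compose_filterlim[OF eventually_gt_at_top filterlim_snd])
    then show "\<forall>\<^sub>F (m, x) in at_top \<times>\<^sub>F at_top. norm (a m x) \<le> D * (C\<^sup>2 * inverse (real m ^ 2))"
      by eventually_elim (use bound in auto)
  qed simp
  show sg: "summable (\<lambda>m. real (card (coprime_layer m)) / real m ^ Suc n)"
    by (rule summable_comparison_test'[OF summable_mult[OF sq, of "C\<^sup>2"], of 0])
      (use gs in \<open>simp add: g_def\<close>)
  \<comment> \<open>For fixed \<open>x\<close> only finitely many terms are nonzero, so the division
    can be moved out of the series.\<close>
  have fin: "(\<Sum>m. a m x) = (\<Sum>m. g m * gauss_power_sum n (x / real m)) / x ^ Suc n" if "x > 0" for x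
  proof -
    have "summable (\<lambda>m. g m * gauss_power_sum n (x / real m))"
    proof (rule summable_finite[of "{..nat \<lfloor>x\<rfloor>}"])
      fix m assume "m \<notin> {..nat \<lfloor>x\<rfloor>}"
      then have "x < real m" "m > 0" by (simp_all add: not_le) linarith
      then have "x / real m < 1" by simp
      then show "g m * gauss_power_sum n (x / real m) = 0"
        by (simp add: gauss_power_sum_def gauss_upto_empty)
    qed simp
    then show ?thesis unfolding a_def by (rule suminf_divide)
  qed
  have "\<forall>\<^sub>F x in at_top. (\<Sum>m. a m x) = (\<Sum>m. g m * gauss_power_sum n (x / real m)) / x ^ Suc n"
    using eventually_gt_at_top[of 0] by eventually_elim (rule fin)
  moreover have "((\<lambda>x. \<Sum>m. a m x) \<longlongrightarrow> pi / real (Suc n) * (\<Sum>m. g m / real m ^ Suc n)) at_top"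
    using T suminf_mult[OF sg, of "pi / real (Suc n)"] by (simp add: g_def)
  ultimately show "((\<lambda>x. (\<Sum>m. real (card (coprime_layer m)) * gauss_power_sum n (x / real m)) / x ^ Suc n)
      \<longlongrightarrow> pi / real (Suc n) * (\<Sum>m. real (card (coprime_layer m)) / real m ^ Suc n)) at_top"
    unfolding g_def by (rule Lim_transform_eventually[rotated])
qed

section \<open>The asymptotics of the moment\<close>

theorem theorem3:
  fixes n :: nat
  assumes "n > 2"
  shows "\<exists>c :: real. c \<noteq> 0 \<and>
           (\<lambda>x :: real. gcd_moment x n) \<sim>[at_top] (\<lambda>x. c * x ^ (n - 1))"
proof -
  define G where "G = (\<Sum>m. real (card (coprime_layer m)) / real m ^ Suc n)"
  define W where "W x = (\<Sum>(z, w)\<in>gauss_upto x \<times> gauss_upto x. ideal_norm (gauss_gcd z w) ^ n)" for x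
  \<comment> \<open>The 4 counts the generators of the gcd; \<open>pi ^ 2\<close> comes from the
    number of pairs, asymptotic to \<open>(pi * x) ^ 2\<close>.\<close>
  define c where "c = (pi / real (Suc n) * G / 4) / pi ^ 2"
  have "card (coprime_layer 1) > 0"
    using coprime_layer_1_nonempty finite_coprime_layer by (simp add: card_gt_0_iff)
  then have "G > 0"
    unfolding G_def
    by (intro suminf_pos2[OF coprime_layer_series_tendsto(2)[OF assms], of 1]) auto
  then have "c \<noteq> 0" by (simp add: c_def)
  have "4 * W x = (\<Sum>m. real (card (coprime_layer m)) * gauss_power_sum n (x / real m))" for x
    unfolding W_def sum_gcd_norm_eq sum_coprime_pairs_layers ..
  from this[symmetric] have W: "W x / x ^ Suc n =
      (\<Sum>m. real (card (coprime_layer m)) * gauss_power_sum n (x / real m)) / x ^ Suc n / 4" for x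
    by simp
  have "((\<lambda>x. W x / x ^ Suc n) \<longlongrightarrow> pi / real (Suc n) * G / 4) at_top"
    unfolding W G_def
    by (intro tendsto_divide coprime_layer_series_tendsto(1) assms tendsto_const) simp
  from tendsto_divide[OF this tendsto_power[OF card_gauss_upto_tendsto, of 2]]
  have "((\<lambda>x. (W x / x ^ Suc n) / (real (card (gauss_upto x)) / x) ^ 2) \<longlongrightarrow> c) at_top"
    by (simp add: c_def)
  moreover have "\<forall>\<^sub>F x in at_top. (W x / x ^ Suc n) / (real (card (gauss_upto x)) / x) ^ 2 =
      gcd_moment x n / x ^ (n - 1)"
    using eventually_ge_at_top[of 1]
  proof eventually_elim
    case (elim x)
    \<comment> \<open>Two of the \<open>Suc n\<close> powers of \<open>x\<close> normalise the
      number of pairs, leaving \<open>x ^ (n - 1)\<close> for the moment.\<close>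
    have "Suc n = (n - 1) + 2" using assms by simp
    then have "x ^ Suc n = x ^ (n - 1) * x ^ 2" by (metis power_add)
    then show ?case
      unfolding gcd_moment_eq[OF elim] W_def using elim by (simp add: power_divide)
  qed
  ultimately have "((\<lambda>x. gcd_moment x n / x ^ (n - 1)) \<longlongrightarrow> c) at_top"
    by (rule Lim_transform_eventually)
  from asymp_equivI'_const[OF this \<open>c \<noteq> 0\<close>] \<open>c \<noteq> 0\<close> show ?thesis by blast
qed

end
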